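(* Let $k\in\{2,3\}$ and $n\geqslant k$. For every $k$-dimensional subspace $H_k$ of $\mathbb{R}^n$, the $k$-dimensional volume of the orthogonal projection of the $n$-dimensional cross-polytope $B_1^n=\{x\in\mathbb{R}^n \mid |x_1|+\cdots+|x_n|\leqslant 1\}$ onto $H_k$ is at most the volume of the $k$-dimensional cross-polytope, i.e. $\operatorname{vol}(B_1^n \mid H_k)\leqslant \frac{2^k}{k!}$, and this bound is attained only on coordinate subspaces.
   Context: $B_1^n$ denotes the standard cross-polytope, the convex hull of $\pm e_1,\dots,\pm e_n$; $K\mid H_k$ denotes the orthogonal projection of $K$ onto $H_k$, and $\operatorname{vol}$ is $k$-dimensional volume in $H_k$. *)

theory Defs
  imports "HOL-Analysis.Analysis"
begin

definition cross_polytope :: "(real ^ 'n) set" where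
  "cross_polytope = {x. (\<Sum>i\<in>UNIV. \<bar>x $ i\<bar>) \<le> 1}"

definition orth_proj :: "(real ^ 'n) set \<Rightarrow> real ^ 'n \<Rightarrow> real ^ 'n" where
  "orth_proj H x = (THE y. y \<in> H \<and> (\<forall>h\<in>H. (x - y) \<bullet> h = 0))"

definition proj_set :: "(real ^ 'n) set \<Rightarrow> (real ^ 'n) set \<Rightarrow> (real ^ 'n) set" where
  "proj_set K H = orth_proj H ` K"

text \<open>k-dimensional volume inside a k-dimensional subspace H of R^n, where k = CARD('k):
  pull back along a linear isometry of R^k onto H and take Lebesgue measure there
  (independent of the chosen isometry).\<close>
definition subspace_vol :: "'k::finite itself \<Rightarrow> (real ^ 'n) set \<Rightarrow> (real ^ 'n) set \<Rightarrow> real" where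
  "subspace_vol _ H S =
     measure lebesgue
       ((SOME f :: real ^ 'k \<Rightarrow> real ^ 'n. linear f \<and> (\<forall>x. norm (f x) = norm x) \<and> range f = H) -` S)"

definition coordinate_subspace :: "nat \<Rightarrow> (real ^ 'n) set \<Rightarrow> bool" where
  "coordinate_subspace k H \<longleftrightarrow> (\<exists>I. card I = k \<and> H = span ((\<lambda>i. axis i 1) ` I))"

end

(* Let A be the adjoint of the isometry f of R^k onto H, so that the pulled back projection is
A(B), B the cross-polytope, and the vectors u_i = A(e_i) form a tight frame; in particular
|A c| <= |c|. Up to a null set and an arbitrarily small dilation, A(B) is triangulated by simplices
{sum of x_j v_j | x_j > 0, sum of x_j <= 1}, each with k of the signed vectors u_i in the place of
the v_j, such that the cones over different simplices are disjoint. If D is the sum of the moduli of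
the determinants of these bases, then vol A(B) <= D / k!. On the other hand the images of the
positive part of the unit ball under the bases lie, by |A c| <= |c|, in the unit ball and they are
disjoint, so D <= 2^k. If more than k of the u_i are nonzero, then the images miss an open part of
the ball that does not depend on the triangulation, and the inequality is strict.

The triangulation is obtained by linear programming: x is represented by the c with A c = x that
minimises sum of t_i |c_i| for a generic weight vector t close to (1, ..., 1). *)

theory Submission
  imports Defs
begin

section \<open>Supports, costs and generic weights\<close>

definition vec_supp :: "real ^ 'n \<Rightarrow> 'n set" where
  "vec_supp c = {i. c $ i \<noteq> 0}"

definition cost :: "real ^ 'n \<Rightarrow> real ^ 'n \<Rightarrow> real" where
  "cost t c = (\<Sum>i\<in>UNIV. t $ i * \<bar>c $ i\<bar>)"

definition optimal :: "(real ^ 'n \<Rightarrow> real ^ 'k) \<Rightarrow> real ^ 'n \<Rightarrow> real ^ 'n \<Rightarrow> bool" where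
  "optimal A t c \<longleftrightarrow> (\<forall>d. A d = A c \<longrightarrow> cost t c \<le> cost t d)"

text \<open>Genericity makes the optimum of the linear program unique: along every set of coordinates that
  carries a nonzero kernel vector, some kernel vector changes the cost to first order.\<close>

definition generic :: "(real ^ 'n \<Rightarrow> real ^ 'k) \<Rightarrow> real ^ 'n \<Rightarrow> bool" where
  "generic A t \<longleftrightarrow> (\<forall>s. (\<forall>i. s $ i \<in> {-1, 0, 1}) \<longrightarrow>
     (\<exists>a. a \<noteq> 0 \<and> A a = 0 \<and> vec_supp a \<subseteq> vec_supp s) \<longrightarrow>
     (\<exists>a. A a = 0 \<and> vec_supp a \<subseteq> vec_supp s \<and> (\<Sum>i\<in>UNIV. t $ i * (s $ i * a $ i)) \<noteq> 0))"

lemma bij_betw_vec_lambda_PiE: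
  "bij_betw vec_lambda (UNIV \<rightarrow>\<^sub>E S) {s :: 'a ^ 'n. \<forall>i. s $ i \<in> S}"
  by (rule bij_betw_byWitness[where f' = vec_nth]) auto

lemma card_vectors_over: "card {s :: 'a ^ 'n. \<forall>i. s $ i \<in> S} = card S ^ CARD('n)"
  using bij_betw_same_card[OF bij_betw_vec_lambda_PiE[of S, where 'n = 'n]] by (simp add: card_PiE)

lemma finite_vectors_over:
  assumes "finite S"
  shows "finite {s :: 'a ^ 'n. \<forall>i. s $ i \<in> S}"
  using bij_betw_finite[OF bij_betw_vec_lambda_PiE[of S, where 'n = 'n]] assms
  by (simp add: finite_PiE)

text \<open>For each of the finitely many sign vectors \<open>s\<close> whose support carries a
  nonzero kernel vector \<open>a s\<close>, the weights whose cost has no first-order change along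
  \<open>a s\<close> form the hyperplane orthogonal to \<open>m s\<close>. Finitely many hyperplanes
  do not cover the box of weights between \<open>e\<close> and 1.\<close>

lemma ex_generic:
  fixes A :: "real ^ 'n \<Rightarrow> real ^ 'k"
  assumes "e < 1"
  shows "\<exists>t. (\<forall>i. e < t $ i \<and> t $ i < 1) \<and> generic A t"
proof -
  define S where "S = {s :: real ^ 'n. (\<forall>i. s $ i \<in> {-1, 0, 1}) \<and>
     (\<exists>a. a \<noteq> 0 \<and> A a = 0 \<and> vec_supp a \<subseteq> vec_supp s)}"
  have finS: "finite S"
    by (rule finite_subset[OF _ finite_vectors_over[of "{-1, 0, 1 :: real}"]]) (auto simp: S_def)
  have "\<forall>s\<in>S. \<exists>a. a \<noteq> 0 \<and> A a = 0 \<and> vec_supp a \<subseteq> vec_supp s"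
    by (simp add: S_def)
  then obtain a where a: "\<And>s. s \<in> S \<Longrightarrow> a s \<noteq> 0 \<and> A (a s) = 0 \<and> vec_supp (a s) \<subseteq> vec_supp s"
    by metis
  define m where "m s = (\<chi> i. s $ i * a s $ i)" for s :: "real ^ 'n"
  have m0: "m s \<noteq> 0" if s: "s \<in> S" for s
  proof -
    obtain i where "a s $ i \<noteq> 0" using a[OF s] by (auto simp: vec_eq_iff)
    then have "m s $ i \<noteq> 0" using a[OF s] by (auto simp: m_def vec_supp_def)
    then show ?thesis by auto
  qed
  have "negligible (\<Union>s\<in>S. {t. m s \<bullet> t = 0})"
    using finS m0 by (intro negligible_Union) (auto intro: negligible_hyperplane)
  moreover have "\<not> negligible (box (\<chi> i. e) (\<chi> i. 1) :: (real ^ 'n) set)"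
    using assms by (intro open_not_negligible) (auto simp: interval_ne_empty_cart)
  ultimately have "\<not> box (\<chi> i. e) (\<chi> i. 1) \<subseteq> (\<Union>s\<in>S. {t. m s \<bullet> t = 0})"
    using negligible_subset by blast
  then obtain t where t: "t \<in> box (\<chi> i. e) (\<chi> i. 1)" "\<And>s. s \<in> S \<Longrightarrow> m s \<bullet> t \<noteq> 0"
    by auto
  have "generic A t"
    unfolding generic_def
  proof (intro allI impI)
    fix s :: "real ^ 'n"
    assume "\<forall>i. s $ i \<in> {- 1, 0, 1}" "\<exists>a. a \<noteq> 0 \<and> A a = 0 \<and> vec_supp a \<subseteq> vec_supp s"
    then have "s \<in> S" by (simp add: S_def)
    then show "\<exists>a. A a = 0 \<and> vec_supp a \<subseteq> vec_supp s \<and> (\<Sum>i\<in>UNIV. t $ i * (s $ i * a $ i)) \<noteq> 0"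
      using a[of s] t(2)[of s] by (intro exI[of _ "a s"]) (auto simp: m_def inner_vec_def mult_ac)
  qed
  with t show ?thesis by (auto simp: mem_box_cart)
qed

section \<open>Existence and uniqueness of optimal representations\<close>

lemma continuous_on_cost: "continuous_on S (cost t)"
  unfolding cost_def by (intro continuous_intros)

text \<open>Weights above \<open>e > 0\<close> make the cost control the norm, so the vectors of the
  fibre that cost at most as much as \<open>d\<close> form a compact set.\<close>

lemma ex_optimal:
  fixes A :: "real ^ 'n \<Rightarrow> real ^ 'k"
  assumes A: "linear A" and t: "\<And>i. e < t $ i" and e: "0 < e"
  shows "\<exists>c. A c = A d \<and> optimal A t c"
proof -
  let ?S = "{c. A c = A d} \<inter> {c. cost t c \<le> cost t d}"
  have "closed {c. A c = A d}"
    using A by (intro closed_Collect_eq) (auto intro: linear_continuous_on simp: linear_conv_bounded_linear)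
  moreover have "closed {c. cost t c \<le> cost t d}"
    by (intro closed_Collect_le continuous_on_cost) auto
  moreover have "bounded ?S"
  proof (rule boundedI)
    fix c assume c: "c \<in> ?S"
    have "e * norm c \<le> e * (\<Sum>i\<in>UNIV. \<bar>c $ i\<bar>)"
      using norm_le_l1_cart[of c] e by (simp add: mult_left_mono)
    also have "\<dots> \<le> cost t c"
      unfolding cost_def sum_distrib_left
      using t by (intro sum_mono mult_right_mono) (auto intro: less_imp_le)
    also have "\<dots> \<le> cost t d" using c by simp
    finally show "norm c \<le> cost t d / e" using e by (simp add: field_simps)
  qed
  ultimately have "compact ?S"
    by (simp add: closed_Int compact_eq_bounded_closed)
  moreover have "?S \<noteq> {}" by auto
  ultimately obtain c where c: "c \<in> ?S" "\<And>b. b \<in> ?S \<Longrightarrow> cost t c \<le> cost t b"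
    using continuous_attains_inf[OF _ _ continuous_on_cost] by metis
  have "optimal A t c"
    unfolding optimal_def
  proof (intro allI impI)
    fix b assume "A b = A c"
    then show "cost t c \<le> cost t b" using c(1) c(2)[of b] by (cases "cost t b \<le> cost t d") auto
  qed
  with c show ?thesis by auto
qed

text \<open>Provides a step length \<open>\<eta>\<close> such that adding or subtracting
  \<open>\<eta> *\<^sub>R a\<close> reverses no sign of \<open>c\<close>; exchange arguments can
  then compute costs exactly.\<close>

lemma ex_small_multiple:
  fixes a c :: "real ^ 'n"
  assumes "vec_supp a \<subseteq> vec_supp c"
  shows "\<exists>\<eta>>0. \<forall>i. \<eta> * \<bar>a $ i\<bar> \<le> \<bar>c $ i\<bar>"
proof -
  \<comment> \<open>The 1 stands for the coordinates where \<open>a\<close> vanishes, which impose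
    no bound, and keeps the minimum positive.\<close>
  define \<eta> where "\<eta> = Min (range (\<lambda>i. if a $ i = 0 then 1 else \<bar>c $ i\<bar> / \<bar>a $ i\<bar>))"
  have "\<eta> > 0"
    using assms unfolding \<eta>_def by (subst Min_gr_iff) (auto simp: vec_supp_def)
  moreover have "\<eta> * \<bar>a $ i\<bar> \<le> \<bar>c $ i\<bar>" for i
  proof (cases "a $ i = 0")
    case False
    have "\<eta> \<le> (if a $ i = 0 then 1 else \<bar>c $ i\<bar> / \<bar>a $ i\<bar>)"
      unfolding \<eta>_def by (rule Min_le) auto
    with False show ?thesis by (simp add: field_simps)
  qed auto
  ultimately show ?thesis by blast
qed

text \<open>Otherwise genericity gives a kernel vector \<open>b\<close> along which the cost is
  linear near \<open>c\<close> with nonzero slope \<open>D\<close>, and a step in one of the two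
  directions would lower the cost within the fibre.\<close>

lemma optimal_supp_independent:
  fixes A :: "real ^ 'n \<Rightarrow> real ^ 'k"
  assumes A: "linear A" and gen: "generic A t" and opt: "optimal A t c"
    and a: "A a = 0" "vec_supp a \<subseteq> vec_supp c"
  shows "a = 0"
proof (rule ccontr)
  assume "a \<noteq> 0"
  define s where "s = (\<chi> i. sgn (c $ i))"
  have s: "vec_supp s = vec_supp c" "\<forall>i. s $ i \<in> {-1, 0, 1}"
    by (auto simp: s_def vec_supp_def sgn_if)
  obtain b where b: "A b = 0" "vec_supp b \<subseteq> vec_supp c"
      "(\<Sum>i\<in>UNIV. t $ i * (s $ i * b $ i)) \<noteq> 0"
    using gen a s \<open>a \<noteq> 0\<close> unfolding generic_def by metis
  define D where "D = (\<Sum>i\<in>UNIV. t $ i * (s $ i * b $ i))"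
  obtain \<eta> where \<eta>: "\<eta> > 0" "\<And>i. \<eta> * \<bar>b $ i\<bar> \<le> \<bar>c $ i\<bar>"
    using ex_small_multiple[OF b(2)] by blast
  \<comment> \<open>A step of length \<open>\<eta>\<close> takes no coordinate of \<open>c\<close>
    beyond zero, so each modulus changes exactly by its first-order term.\<close>
  have "cost t (c + r *\<^sub>R b) = cost t c + r * D" if r: "\<bar>r\<bar> = \<eta>" for r
  proof -
    have "\<bar>c $ i + r * b $ i\<bar> = \<bar>c $ i\<bar> + r * (s $ i * b $ i)" for i
    proof -
      have "\<bar>r * b $ i\<bar> \<le> \<bar>c $ i\<bar>" using \<eta>(2)[of i] r by (simp add: abs_mult)
      then show ?thesis by (auto simp: s_def sgn_if abs_if split: if_splits)
    qed
    then show ?thesis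
      by (simp add: cost_def D_def sum_distrib_left distrib_left sum.distrib mult_ac)
  qed
  moreover have "A (c + r *\<^sub>R b) = A c" for r
    using A b by (simp add: linear_add linear_scale)
  ultimately have "0 \<le> r * D" if "\<bar>r\<bar> = \<eta>" for r
    using opt that unfolding optimal_def by (metis add_le_cancel_left add.right_neutral)
  from this[of \<eta>] this[of "- \<eta>"] have "\<eta> * D = 0" using \<eta> by simp
  with \<eta> b show False by (simp add: D_def)
qed

text \<open>The midpoint of two optimal representations is again optimal, which rules out cancellation;
  so its support contains both supports.\<close>

lemma optimal_unique:
  fixes A :: "real ^ 'n \<Rightarrow> real ^ 'k"
  assumes A: "linear A" and gen: "generic A t" and t: "\<And>i. 0 < t $ i"
    and opt: "optimal A t c" "optimal A t d" and eq: "A c = A d"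
  shows "c = d"
proof -
  define m where "m = (1/2) *\<^sub>R (c + d)"
  have Am: "A m = A c" using A eq by (simp add: m_def linear_add linear_scale flip: scaleR_2)
  have cd: "cost t c = cost t d" using opt eq by (simp add: optimal_def order_antisym)
  have term_le: "t $ i * \<bar>m $ i\<bar> \<le> (t $ i * \<bar>c $ i\<bar> + t $ i * \<bar>d $ i\<bar>) / 2" for i
  proof -
    have "\<bar>m $ i\<bar> \<le> (\<bar>c $ i\<bar> + \<bar>d $ i\<bar>) / 2" by (simp add: m_def)
    then have "t $ i * \<bar>m $ i\<bar> \<le> t $ i * ((\<bar>c $ i\<bar> + \<bar>d $ i\<bar>) / 2)"
      using t[of i] by (intro mult_left_mono) auto
    then show ?thesis by (simp add: distrib_left)
  qed
  have half: "(\<Sum>i\<in>UNIV. (t $ i * \<bar>c $ i\<bar> + t $ i * \<bar>d $ i\<bar>) / 2) = cost t c"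
    using cd by (simp add: cost_def sum.distrib flip: sum_divide_distrib)
  have ge: "cost t c \<le> cost t m" using opt Am by (simp add: optimal_def)
  have term_eq: "t $ i * \<bar>m $ i\<bar> = (t $ i * \<bar>c $ i\<bar> + t $ i * \<bar>d $ i\<bar>) / 2" for i
  proof (rule ccontr)
    assume "t $ i * \<bar>m $ i\<bar> \<noteq> (t $ i * \<bar>c $ i\<bar> + t $ i * \<bar>d $ i\<bar>) / 2"
    then have "cost t m < (\<Sum>i\<in>UNIV. (t $ i * \<bar>c $ i\<bar> + t $ i * \<bar>d $ i\<bar>) / 2)"
      unfolding cost_def using term_le by (intro sum_strict_mono_ex1) (auto simp: less_le)
    with half ge show False by simp
  qed
  have "optimal A t m"
    unfolding optimal_def
  proof (intro allI impI)
    fix b assume "A b = A m"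
    moreover have "cost t m = cost t c"
      using half by (simp add: term_eq cost_def[of t m])
    ultimately show "cost t m \<le> cost t b" using opt(1) Am by (simp add: optimal_def)
  qed
  \<comment> \<open>Without cancellation, \<open>m\<close> vanishes only where \<open>c\<close> and
    \<open>d\<close> both do. The kernel vector \<open>c - d\<close> is then supported where the
    optimal \<open>m\<close> is, which forces it to be 0.\<close>
  moreover have "vec_supp (c - d) \<subseteq> vec_supp m"
  proof
    fix i assume "i \<in> vec_supp (c - d)"
    then have "0 < \<bar>c $ i\<bar> + \<bar>d $ i\<bar>" by (auto simp: vec_supp_def)
    moreover have "t $ i * \<bar>m $ i\<bar> = t $ i * ((\<bar>c $ i\<bar> + \<bar>d $ i\<bar>) / 2)"
      using term_eq[of i] by (simp add: distrib_left)
    ultimately have "\<bar>m $ i\<bar> > 0" using t[of i] by simp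
    then show "i \<in> vec_supp m" by (simp add: vec_supp_def)
  qed
  moreover have "A (c - d) = 0" using A eq by (simp add: linear_diff)
  ultimately have "c - d = 0" using optimal_supp_independent[OF A gen] by blast
  then show ?thesis by simp
qed

text \<open>Exchange argument: replace the part \<open>\<eta> *\<^sub>R b\<close> of
  \<open>c\<close> by \<open>\<eta> *\<^sub>R d\<close>. As the signs agree, removing that part
  saves exactly \<open>\<eta> * cost t b\<close>, so \<open>d\<close> cannot be cheaper than
  \<open>b\<close>. Optimality is therefore a property of the sign pattern, inherited when some
  signs are set to 0.\<close>

lemma optimal_same_signs:
  fixes A :: "real ^ 'n \<Rightarrow> real ^ 'k"
  assumes A: "linear A" and t: "\<And>i. 0 < t $ i" and opt: "optimal A t c"
    and sgn: "\<And>i. b $ i \<noteq> 0 \<Longrightarrow> sgn (b $ i) = sgn (c $ i)"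
  shows "optimal A t b"
  unfolding optimal_def
proof (intro allI impI)
  fix d assume d: "A d = A b"
  have "vec_supp b \<subseteq> vec_supp c"
    using sgn by (auto simp: vec_supp_def) (metis sgn_0_0)
  then obtain \<eta> where \<eta>: "\<eta> > 0" "\<And>i. \<eta> * \<bar>b $ i\<bar> \<le> \<bar>c $ i\<bar>"
    using ex_small_multiple by blast
  define x where "x = c - \<eta> *\<^sub>R b + \<eta> *\<^sub>R d"
  have "A x = A c" using A d by (simp add: x_def linear_add linear_diff linear_scale)
  then have "cost t c \<le> cost t x" using opt by (simp add: optimal_def)
  also have "\<dots> \<le> cost t c - \<eta> * cost t b + \<eta> * cost t d"
  proof -
    have "\<bar>x $ i\<bar> \<le> \<bar>c $ i\<bar> - \<eta> * \<bar>b $ i\<bar> + \<eta> * \<bar>d $ i\<bar>" for i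
    proof -
      have "\<bar>c $ i - \<eta> * b $ i\<bar> = \<bar>c $ i\<bar> - \<eta> * \<bar>b $ i\<bar>"
      proof (cases "b $ i = 0")
        case False
        with sgn[of i] \<eta>(2)[of i] \<eta>(1) show ?thesis
          by (cases "b $ i > 0"; cases "c $ i > 0"; cases "c $ i = 0") (auto simp: sgn_if)
      qed auto
      moreover have "\<bar>\<eta> * d $ i\<bar> = \<eta> * \<bar>d $ i\<bar>" using \<eta>(1) by (simp add: abs_mult)
      ultimately show ?thesis
        using abs_triangle_ineq[of "c $ i - \<eta> * b $ i" "\<eta> * d $ i"] by (simp add: x_def)
    qed
    then have "cost t x \<le> (\<Sum>i\<in>UNIV. t $ i * (\<bar>c $ i\<bar> - \<eta> * \<bar>b $ i\<bar> + \<eta> * \<bar>d $ i\<bar>))"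
      unfolding cost_def using t by (intro sum_mono mult_left_mono) (auto intro: less_imp_le)
    also have "\<dots> = cost t c - \<eta> * cost t b + \<eta> * cost t d"
      by (simp add: cost_def sum_distrib_left distrib_left right_diff_distrib sum.distrib
          sum_subtractf mult_ac)
    finally show ?thesis .
  qed
  finally have "\<eta> * cost t b \<le> \<eta> * cost t d" by simp
  then show "cost t b \<le> cost t d" using \<eta>(1) by simp
qed

section \<open>Volumes of sign-symmetric sets, simplices and the cross-polytope\<close>

definition pos_orthant :: "(real ^ 'n) set" where
  "pos_orthant = {x. \<forall>i. 0 < x $ i}"

lemma negligible_zero_coordinate: "negligible {x :: real ^ 'n. \<exists>i. x $ i = 0}"
proof -
  have "{x :: real ^ 'n. \<exists>i. x $ i = 0} = (\<Union>i. {x. axis i 1 \<bullet> x = 0})"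
    by (auto simp: inner_axis')
  also have "negligible \<dots>"
    by (intro negligible_Union) (auto intro!: negligible_hyperplane simp: axis_eq_0_iff)
  finally show ?thesis .
qed

lemma measure_Diff_negligible:
  assumes "S \<in> lmeasurable" "negligible N"
  shows "measure lebesgue (S - N) = measure lebesgue S"
  using assms by (intro measure_Diff_null_set) (auto simp: negligible_iff_null_sets)

lemma pos_orthant_lebesgue: "(pos_orthant :: (real ^ 'n) set) \<in> sets lebesgue"
proof -
  have "pos_orthant = (\<Inter>i. {x :: real ^ 'n. 0 < x $ i})" by (auto simp: pos_orthant_def)
  moreover have "open {x :: real ^ 'n. 0 < x $ i}" for i
    by (intro open_Collect_less continuous_intros)
  ultimately have "open (pos_orthant :: (real ^ 'n) set)" by (metis finite open_INT)
  then show ?thesis by (simp add: borel_open)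
qed

text \<open>The sign changes \<open>D s\<close> preserve measure and carry the positive part to
  disjoint pieces that fill \<open>S\<close> up to the coordinate hyperplanes.\<close>

lemma measure_sign_symmetric:
  fixes S :: "(real ^ 'k) set"
  assumes S: "S \<in> lmeasurable"
    and sym: "\<And>x y. x \<in> S \<Longrightarrow> (\<And>i. \<bar>y $ i\<bar> = \<bar>x $ i\<bar>) \<Longrightarrow> y \<in> S"
  shows "measure lebesgue S = 2 ^ CARD('k) * measure lebesgue (S \<inter> pos_orthant)"
proof -
  define Q where "Q = {s :: real ^ 'k. \<forall>i. s $ i \<in> {-1, 1}}"
  define D where "D s x = (\<chi> i. s $ i * x $ i)" for s x :: "real ^ 'k"
  define P where "P = S \<inter> pos_orthant"
  have P: "P \<in> lmeasurable"
    unfolding P_def using S by (intro fmeasurable_Int_fmeasurable pos_orthant_lebesgue)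
  have cardQ: "card Q = 2 ^ CARD('k)"
    unfolding Q_def card_vectors_over by (simp add: numeral_2_eq_2)
  then have finQ: "finite Q" by (metis card.infinite power_not_zero zero_neq_numeral)
  have sgnD: "sgn (D s x $ i) = s $ i" if "s \<in> Q" "x \<in> P" for s x i
  proof -
    have "s $ i = -1 \<or> s $ i = 1" "0 < x $ i"
      using that by (auto simp: Q_def P_def pos_orthant_def)
    then show ?thesis by (auto simp: D_def sgn_mult)
  qed
  have disj: "D s ` P \<inter> D s' ` P = {}" if ss: "s \<in> Q" "s' \<in> Q" "s \<noteq> s'" for s s'
  proof (rule ccontr)
    assume "D s ` P \<inter> D s' ` P \<noteq> {}"
    then obtain x x' where x: "x \<in> P" "x' \<in> P" "D s x = D s' x'" by blast
    have "s $ i = s' $ i" for i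
      using sgnD[OF ss(1) x(1), of i] sgnD[OF ss(2) x(2), of i] x(3) by simp
    with ss show False by (simp add: vec_eq_iff)
  qed
  have "S - {x. \<exists>i. x $ i = 0} = (\<Union>s\<in>Q. D s ` P)"
  proof (intro equalityI subsetI)
    fix x assume x: "x \<in> S - {x. \<exists>i. x $ i = 0}"
    define s where "s = (\<chi> i. sgn (x $ i))"
    define y where "y = (\<chi> i. \<bar>x $ i\<bar>)"
    have "s \<in> Q" using x by (auto simp: s_def Q_def sgn_if)
    moreover have "y \<in> P" using x sym[of x y] by (auto simp: y_def P_def pos_orthant_def)
    moreover have "x = D s y" by (simp add: D_def s_def y_def vec_eq_iff sgn_mult_abs)
    ultimately show "x \<in> (\<Union>s\<in>Q. D s ` P)" by blast
  next
    fix x assume "x \<in> (\<Union>s\<in>Q. D s ` P)"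
    then obtain s y where s: "s \<in> Q" and y: "y \<in> P" and x: "x = D s y" by blast
    have "\<bar>s $ i\<bar> = 1" for i using s by (auto simp: Q_def dest: spec[of _ i])
    then have abs: "\<bar>x $ i\<bar> = \<bar>y $ i\<bar>" for i by (simp add: x D_def abs_mult)
    have "x $ i \<noteq> 0" for i using y abs[of i] by (auto simp: P_def pos_orthant_def dest: spec[of _ i])
    moreover have "x \<in> S" using y sym[of y x] abs by (simp add: P_def)
    ultimately show "x \<in> S - {x. \<exists>i. x $ i = 0}" by simp
  qed
  then have "measure lebesgue S = measure lebesgue (\<Union>s\<in>Q. D s ` P)"
    using measure_Diff_negligible[OF S negligible_zero_coordinate] by simp
  also have "\<dots> = (\<Sum>s\<in>Q. measure lebesgue (D s ` P))"
    using finQ disj measurable_stretch[OF P]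
    by (intro measure_UNION') (auto simp: D_def pairwise_def disjnt_def)
  also have "\<dots> = (\<Sum>s\<in>Q. measure lebesgue P)"
  proof (rule sum.cong[OF refl])
    fix s assume s: "s \<in> Q"
    have "\<bar>s $ i\<bar> = 1" for i using s by (auto simp: Q_def dest: spec[of _ i])
    then have "\<bar>\<Prod>i\<in>UNIV. s $ i\<bar> = 1" by (simp add: abs_prod)
    then show "measure lebesgue (D s ` P) = measure lebesgue P"
      using measure_stretch[OF P, of "vec_nth s"] by (simp add: D_def)
  qed
  finally show ?thesis by (simp add: cardQ P_def)
qed

definition pos_simplex :: "real \<Rightarrow> (real ^ 'n) set" where
  "pos_simplex r = {x \<in> pos_orthant. (\<Sum>i\<in>UNIV. x $ i) \<le> r}"

lemma std_simplex_cart: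
  "convex hull (insert 0 Basis) = {x :: real ^ 'n. (\<forall>i. 0 \<le> x $ i) \<and> (\<Sum>i\<in>UNIV. x $ i) \<le> 1}"
proof -
  have B: "Basis = range (\<lambda>i. axis i 1 :: real ^ 'n)" by (auto simp: Basis_vec_def)
  have "inj (\<lambda>i. axis i 1 :: real ^ 'n)" by (auto simp: inj_def axis_eq_axis)
  then have "sum ((\<bullet>) x) Basis = (\<Sum>i\<in>UNIV. x $ i)" for x :: "real ^ 'n"
    unfolding B by (subst sum.reindex) (auto simp: inner_axis)
  then show ?thesis by (subst std_simplex) (auto simp: B inner_axis)
qed

lemma pos_simplex_1:
  "(pos_simplex 1 :: (real ^ 'n) set) \<in> lmeasurable"
  "measure lebesgue (pos_simplex 1 :: (real ^ 'n) set) = 1 / fact CARD('n)"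
proof -
  let ?C = "convex hull (insert 0 Basis) :: (real ^ 'n) set"
  let ?N = "{x :: real ^ 'n. \<exists>i. x $ i = 0}"
  have C: "compact ?C" by (intro compact_convex_hull) (simp add: finite_imp_compact)
  have eq: "pos_simplex 1 = ?C - ?N"
    by (auto simp: pos_simplex_def pos_orthant_def std_simplex_cart less_le)
  show "(pos_simplex 1 :: (real ^ 'n) set) \<in> lmeasurable"
    unfolding eq by (intro fmeasurable_Diff lmeasurable_compact[OF C]
        negligible_imp_sets[OF negligible_zero_coordinate])
  have "measure lebesgue (pos_simplex 1 :: (real ^ 'n) set) = measure lebesgue ?C"
    unfolding eq by (intro measure_Diff_negligible lmeasurable_compact C negligible_zero_coordinate)
  also have "\<dots> = measure lborel ?C"
    by (intro measure_completion) (use C in \<open>simp add: borel_compact\<close>)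
  finally show "measure lebesgue (pos_simplex 1 :: (real ^ 'n) set) = 1 / fact CARD('n)"
    by (simp add: content_std_simplex)
qed

lemma pos_simplex_scaled:
  assumes "0 < r"
  shows "(pos_simplex r :: (real ^ 'n) set) \<in> lmeasurable"
    and "measure lebesgue (pos_simplex r :: (real ^ 'n) set) = r ^ CARD('n) / fact CARD('n)"
proof -
  have eq: "pos_simplex r = (\<lambda>x :: real ^ 'n. \<chi> i. r * x $ i) ` pos_simplex 1"
  proof (intro equalityI subsetI)
    fix x :: "real ^ 'n" assume x: "x \<in> pos_simplex r"
    have "(\<chi> i. x $ i / r) \<in> pos_simplex 1"
      using x assms by (auto simp: pos_simplex_def pos_orthant_def simp flip: sum_divide_distrib)
    moreover have "x = (\<chi> i. r * (\<chi> i. x $ i / r) $ i)" using assms by (simp add: vec_eq_iff)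
    ultimately show "x \<in> (\<lambda>x. \<chi> i. r * x $ i) ` pos_simplex 1" by blast
  next
    fix x :: "real ^ 'n" assume "x \<in> (\<lambda>x. \<chi> i. r * x $ i) ` pos_simplex 1"
    then show "x \<in> pos_simplex r"
      using assms by (auto simp: pos_simplex_def pos_orthant_def simp flip: sum_distrib_left)
  qed
  show "(pos_simplex r :: (real ^ 'n) set) \<in> lmeasurable"
    unfolding eq using measurable_stretch[OF pos_simplex_1(1), of "\<lambda>_. r"] by simp
  show "measure lebesgue (pos_simplex r :: (real ^ 'n) set) = r ^ CARD('n) / fact CARD('n)"
    unfolding eq using assms by (subst measure_stretch) (simp_all add: pos_simplex_1)
qed

lemma compact_cross_polytope: "compact (cross_polytope :: (real ^ 'n) set)"
proof -
  have "closed (cross_polytope :: (real ^ 'n) set)"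
    unfolding cross_polytope_def by (intro closed_Collect_le continuous_intros)
  moreover have "bounded (cross_polytope :: (real ^ 'n) set)"
    using norm_le_l1_cart order_trans by (intro boundedI[of _ 1]) (auto simp: cross_polytope_def)
  ultimately show ?thesis by (simp add: compact_eq_bounded_closed)
qed

lemma measure_cross_polytope:
  "measure lebesgue (cross_polytope :: (real ^ 'k) set) = 2 ^ CARD('k) / fact CARD('k)"
proof -
  have "cross_polytope \<inter> pos_orthant = (pos_simplex 1 :: (real ^ 'k) set)"
    by (auto simp: cross_polytope_def pos_simplex_def pos_orthant_def less_imp_le)
  then show ?thesis
    using measure_sign_symmetric[OF lmeasurable_compact[OF compact_cross_polytope], where 'k = 'k]
    by (simp add: pos_simplex_1) (simp add: cross_polytope_def)
qed

section \<open>Signed coordinate embeddings and the sparsity of optimal representations\<close>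

text \<open>Meant for a bijection \<open>b\<close> from the support of a sign vector
  \<open>s\<close> onto the indices of the smaller space. Off the support the factor
  \<open>s $ i\<close> is 0, so \<open>b\<close> can be a total function.\<close>

definition signed_embedding :: "('n \<Rightarrow> 'k) \<Rightarrow> real ^ 'n \<Rightarrow> real ^ 'k \<Rightarrow> real ^ 'n" where
  "signed_embedding b s x = (\<chi> i. s $ i * x $ b i)"

lemma linear_signed_embedding: "linear (signed_embedding b s)"
  by (rule linearI) (simp_all add: signed_embedding_def vec_eq_iff algebra_simps)

text \<open>\<open>\<bar>s $ i\<bar>\<close> is the indicator of the support, along which
  \<open>b\<close> reindexes the sum. Squares in place of \<open>g\<close> give the Euclidean norm,
  moduli the l1 norm.\<close>

lemma sum_signed_embedding:
  assumes s: "\<And>i. s $ i \<in> {-1, 0, 1 :: real}" and b: "bij_betw b (vec_supp s) UNIV"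
  shows "(\<Sum>i\<in>UNIV. \<bar>s $ i\<bar> * g (b i)) = (\<Sum>j\<in>UNIV. g j)"
proof -
  have "\<bar>s $ i\<bar> = (if i \<in> vec_supp s then 1 else 0)" for i
    using s[of i] by (auto simp: vec_supp_def)
  then have "(\<Sum>i\<in>UNIV. \<bar>s $ i\<bar> * g (b i)) = (\<Sum>i\<in>vec_supp s. g (b i))"
    by (simp add: if_distrib[of "\<lambda>x. x * _"] sum.If_cases cong: if_cong)
  also have "\<dots> = (\<Sum>j\<in>UNIV. g j)"
    using b by (rule sum.reindex_bij_betw)
  finally show ?thesis .
qed

lemma norm_signed_embedding:
  assumes s: "\<And>i. s $ i \<in> {-1, 0, 1 :: real}" and b: "bij_betw b (vec_supp s) UNIV"
  shows "norm (signed_embedding b s x) = norm x"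
proof -
  have "(s $ i * y)\<^sup>2 = \<bar>s $ i\<bar> * y\<^sup>2" for i y
    using s[of i] by auto
  then show ?thesis
    using sum_signed_embedding[OF assms, of "\<lambda>j. (x $ j)\<^sup>2"]
    by (simp add: norm_vec_def L2_set_def signed_embedding_def)
qed

lemma dim_supp: "dim {c :: real ^ 'n. vec_supp c \<subseteq> T} = card T"
proof -
  have "{c :: real ^ 'n. vec_supp c \<subseteq> T} = {c. \<forall>i. i \<notin> T \<longrightarrow> c $ i = 0}"
    by (auto simp: vec_supp_def)
  then show ?thesis using dim_substandard_cart[of T, where 'a = real]
    by (simp add: dim_vec_eq)
qed

text \<open>By genericity \<open>A\<close> is injective on the vectors supported in
  \<open>vec_supp c\<close>, a space whose dimension is the size of that support.\<close>

lemma card_supp_optimal: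
  fixes A :: "real ^ 'n \<Rightarrow> real ^ 'k"
  assumes A: "linear A" and gen: "generic A t" and opt: "optimal A t c"
  shows "card (vec_supp c) \<le> CARD('k)"
proof -
  let ?W = "{a :: real ^ 'n. vec_supp a \<subseteq> vec_supp c}"
  have W: "subspace ?W"
    by (auto simp: subspace_def vec_supp_def subset_iff) force
  have "inj_on A ?W"
  proof (rule inj_onI)
    fix x y assume xy: "x \<in> ?W" "y \<in> ?W" "A x = A y"
    have "x - y \<in> ?W" using subspace_diff[OF W] xy by blast
    moreover have "A (x - y) = 0" using A xy by (simp add: linear_diff)
    ultimately have "x - y = 0" using optimal_supp_independent[OF assms] by blast
    then show "x = y" by simp
  qed
  then have "inj_on A (span ?W)" by (simp only: span_eq_iff[THEN iffD2, OF W])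
  then have "dim (A ` ?W) = dim ?W" by (rule dim_image_eq[OF A])
  moreover have "dim (A ` ?W) \<le> CARD('k)"
    using dim_subset_UNIV[of "A ` ?W"] by simp
  ultimately show ?thesis by (simp add: dim_supp)
qed

section \<open>The volume bound by triangulation\<close>

lemma lmeasurable_linear_cross_polytope:
  fixes A :: "real ^ 'n \<Rightarrow> real ^ 'k"
  assumes "linear A"
  shows "A ` cross_polytope \<in> lmeasurable"
  using assms
  by (intro lmeasurable_compact compact_continuous_image compact_cross_polytope
      linear_continuous_on) (simp add: linear_conv_bounded_linear)

text \<open>Weights between \<open>e\<close> and 1 cost the factor \<open>e ^ CARD('k)\<close>.
  \<open>U\<close> is a part of the ball missed by the images of its positive part; the condition on
  \<open>U\<close> speaks of all sparse vectors, so that it is independent of the weights. The empty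
  \<open>U\<close> gives the plain bound, an open nonempty one the strict inequality.\<close>

lemma measure_projection_le_aux:
  fixes A :: "real ^ 'n \<Rightarrow> real ^ 'k::{finite, wellorder}"
  assumes A: "linear A" and normA: "\<And>c. norm (A c) \<le> norm c"
    and U: "U \<in> lmeasurable" "U \<subseteq> ball 0 1"
    and avoid: "\<And>c. A c \<in> U \<Longrightarrow> card (vec_supp c) \<le> CARD('k::_) \<Longrightarrow> 1 \<le> norm c"
    and e: "0 < e" "e < 1"
  shows "e ^ CARD('k::_) * (measure lebesgue (A ` cross_polytope) * measure lebesgue (ball 0 1 :: (real ^ 'k::_) set))
      \<le> 2 ^ CARD('k::_) / fact CARD('k::_) * (measure lebesgue (ball 0 1 :: (real ^ 'k::_) set) - measure lebesgue U)"
proof -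
  let ?k = "CARD('k::_)"
  let ?B = "ball 0 1 :: (real ^ 'k::_) set"
  obtain t where t: "\<And>i. e < t $ i" "\<And>i. t $ i < 1" and gen: "generic A t"
    using ex_generic[OF e(2), of A] by blast
  have t0: "0 < t $ i" for i using t(1)[of i] e by linarith
  \<comment> \<open>Index set of the triangulation: the nonzero entries of \<open>s\<close> select k
    of the vectors u_i together with their signs.\<close>
  define F where "F = {s. (\<forall>i. s $ i \<in> {-1, 0, 1}) \<and> card (vec_supp s) = ?k \<and> optimal A t s}"
  have finF: "finite F"
    by (rule finite_subset[OF _ finite_vectors_over[of "{-1, 0, 1 :: real}"]]) (auto simp: F_def)
  have "\<forall>s\<in>F. \<exists>b. bij_betw b (vec_supp s) (UNIV :: 'k::_ set)"
    by (auto simp: F_def intro!: finite_same_card_bij)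
  then obtain b where b: "\<And>s. s \<in> F \<Longrightarrow> bij_betw (b s) (vec_supp s) (UNIV :: 'k::_ set)"
    by metis
  define E where "E s = signed_embedding (b s) s" for s
  \<comment> \<open>The columns of the matrix of \<open>L s\<close> are the signed vectors selected
    by \<open>s\<close>, ordered by \<open>b s\<close>.\<close>
  define L where "L s = A \<circ> E s" for s
  have linL: "linear (L s)" for s
    unfolding L_def E_def using A by (intro linear_compose linear_signed_embedding)
  have vals: "s $ i \<in> {-1, 0, 1}" if "s \<in> F" for s i using that by (auto simp: F_def)
  have normE: "norm (E s x) = norm x" if "s \<in> F" for s x
    unfolding E_def using that by (intro norm_signed_embedding vals b)
  have sgnE: "sgn (E s x $ i) = s $ i" if "s \<in> F" "x \<in> pos_orthant" for s x i
  proof -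
    have "s $ i \<in> {-1, 0, 1}" "0 < x $ b s i"
      using that vals by (auto simp: pos_orthant_def)
    then show ?thesis by (auto simp: E_def signed_embedding_def sgn_mult)
  qed
  have optE: "optimal A t (E s x)" if "s \<in> F" "x \<in> pos_orthant" for s x
  proof (rule optimal_same_signs[OF A t0])
    show "optimal A t s" using that by (simp add: F_def)
    show "sgn (E s x $ i) = sgn (s $ i)" for i
      using sgnE[OF that, of i] by (metis sgn_sgn)
  qed
  \<comment> \<open>A common point would have the optimal representations \<open>E s x\<close> and
    \<open>E s' x'\<close>; uniqueness identifies them, and their signs recover \<open>s\<close> and
    \<open>s'\<close>.\<close>
  have disj: "L s ` pos_orthant \<inter> L s' ` pos_orthant = {}" if ss: "s \<in> F" "s' \<in> F" "s \<noteq> s'" for s s'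
  proof (rule ccontr)
    assume "L s ` pos_orthant \<inter> L s' ` pos_orthant \<noteq> {}"
    then obtain x x' where x: "x \<in> pos_orthant" "x' \<in> pos_orthant" "L s x = L s' x'" by blast
    have "E s x = E s' x'"
      using x by (intro optimal_unique[OF A gen t0] optE ss) (auto simp: L_def)
    then have "s $ i = s' $ i" for i
      using sgnE[OF ss(1) x(1), of i] sgnE[OF ss(2) x(2), of i] by simp
    with ss show False by (simp add: vec_eq_iff)
  qed

  \<comment> \<open>Points with a representation by fewer than k coordinates: a finite union of
    subspaces of too small dimension.\<close>
  define N where "N = (\<Union>T\<in>{T. card T < ?k}. A ` {c. vec_supp c \<subseteq> T})"
  have negN: "negligible N"
    unfolding N_def
  proof (intro negligible_Union)
    fix S assume "S \<in> (\<lambda>T. A ` {c. vec_supp c \<subseteq> T}) ` {T. card T < ?k}"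
    then obtain T where T: "card T < ?k" "S = A ` {c. vec_supp c \<subseteq> T}" by blast
    have "dim S \<le> card T" unfolding T using dim_image_le[OF A] by (metis dim_supp)
    with T show "negligible S" by (intro negligible_lowdim) simp
  qed simp
  have cover: "A ` cross_polytope \<subseteq> (\<Union>s\<in>F. L s ` pos_simplex (1 / e)) \<union> N"
  proof
    fix x assume "x \<in> A ` cross_polytope"
    then obtain d where d: "x = A d" "(\<Sum>i\<in>UNIV. \<bar>d $ i\<bar>) \<le> 1" by (auto simp: cross_polytope_def)
    obtain c where c: "A c = A d" "optimal A t c" using ex_optimal[OF A t(1) e(1)] by blast
    show "x \<in> (\<Union>s\<in>F. L s ` pos_simplex (1 / e)) \<union> N"
    proof (cases "card (vec_supp c) < ?k")
      case True
      moreover have "x \<in> A ` {a. vec_supp a \<subseteq> vec_supp c}"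
        using c d by (intro image_eqI[of _ _ c]) auto
      ultimately have "x \<in> N" unfolding N_def by blast
      then show ?thesis by blast
    next
      case False
      \<comment> \<open>Here \<open>c\<close> has exactly k nonzero entries. Its sign pattern is
        itself optimal and names the simplex that contains \<open>x\<close>; the moduli of the
        entries are the coordinates \<open>y\<close> in it.\<close>
      define s where "s = (\<chi> i. sgn (c $ i))"
      have "vec_supp s = vec_supp c" by (auto simp: s_def vec_supp_def sgn_if)
      moreover have "optimal A t s"
        by (rule optimal_same_signs[OF A t0 c(2)]) (simp add: s_def)
      ultimately have s: "s \<in> F"
        using False card_supp_optimal[OF A gen c(2)] by (auto simp: F_def s_def sgn_if)
      have bs: "bij_betw (b s) (vec_supp c) UNIV"
        using b[OF s] \<open>vec_supp s = vec_supp c\<close> by simp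
      define y where "y = (\<chi> j. \<bar>c $ inv_into (vec_supp c) (b s) j\<bar>)"
      have y: "y $ b s i = \<bar>c $ i\<bar>" if "c $ i \<noteq> 0" for i
        using bs that by (simp add: y_def vec_supp_def bij_betw_def inv_into_f_f)
      have Ey: "E s y = c"
      proof -
        have "E s y $ i = c $ i" for i
          using y[of i] by (cases "c $ i = 0")
            (simp_all add: E_def signed_embedding_def s_def sgn_mult_abs)
        then show ?thesis by (simp add: vec_eq_iff)
      qed
      have "0 < y $ j" for j
        using bs inv_into_into[of j "b s" "vec_supp c"]
        by (auto simp: y_def bij_betw_def vec_supp_def)
      \<comment> \<open>The l1 norm of \<open>c\<close> is at most \<open>cost t c / e\<close>, and
        \<open>cost t c\<close> is at most \<open>cost t d\<close>, hence at most 1. This is the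
        source of the dilation by \<open>1 / e\<close>.\<close>
      moreover have "(\<Sum>j\<in>UNIV. y $ j) \<le> 1 / e"
      proof -
        have "\<bar>s $ i\<bar> * y $ b s i = \<bar>c $ i\<bar>" for i
          using y[of i] by (cases "c $ i = 0") (auto simp: s_def sgn_if)
        then have "(\<Sum>j\<in>UNIV. y $ j) = (\<Sum>i\<in>UNIV. \<bar>c $ i\<bar>)"
          using sum_signed_embedding[OF vals[OF s] b[OF s], of "vec_nth y"] by simp
        then have "(\<Sum>j\<in>UNIV. y $ j) * e = e * (\<Sum>i\<in>UNIV. \<bar>c $ i\<bar>)" by simp
        also have "\<dots> \<le> cost t c"
          unfolding cost_def sum_distrib_left
          using t by (intro sum_mono mult_right_mono) (auto intro: less_imp_le)
        also have "\<dots> \<le> cost t d" using c by (simp add: optimal_def)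
        also have "\<dots> \<le> (\<Sum>i\<in>UNIV. \<bar>d $ i\<bar>)"
          unfolding cost_def using t t0
          by (intro sum_mono mult_left_le_one_le) (auto intro: less_imp_le)
        also have "\<dots> \<le> 1" by (fact d(2))
        finally show ?thesis using e by (simp only: pos_le_divide_eq)
      qed
      ultimately have "y \<in> pos_simplex (1 / e)" by (simp add: pos_simplex_def pos_orthant_def)
      moreover have "x = L s y" using Ey c d by (simp add: L_def)
      ultimately have "x \<in> L s ` pos_simplex (1 / e)" by (rule image_eqI[rotated])
      then show ?thesis by (intro UnI1 UN_I[OF s])
    qed
  qed

  have simplex: "(pos_simplex (1 / e) :: (real ^ 'k::_) set) \<in> lmeasurable"
    "measure lebesgue (pos_simplex (1 / e) :: (real ^ 'k::_) set) = (1 / e) ^ ?k / fact ?k"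
    using e by (auto simp: pos_simplex_scaled)
  \<comment> \<open>Bounds the volume of the projection from above through the simplices, and is
    itself bounded through the ball.\<close>
  define \<Delta> where "\<Delta> = (\<Sum>s\<in>F. \<bar>det (matrix (L s))\<bar>)"
  have Usets: "(\<Union>s\<in>F. L s ` pos_simplex (1 / e)) \<in> lmeasurable"
    using finF simplex linL by (intro fmeasurable.finite_UN measurable_linear_image)
  have "measure lebesgue (A ` cross_polytope) \<le> measure lebesgue ((\<Union>s\<in>F. L s ` pos_simplex (1 / e)) \<union> N)"
    using cover Usets negN lmeasurable_linear_cross_polytope[OF A]
    by (intro measure_mono_fmeasurable fmeasurable.Un fmeasurableD)
      (auto intro: negligible_imp_measurable)
  also have "\<dots> \<le> measure lebesgue (\<Union>s\<in>F. L s ` pos_simplex (1 / e)) + measure lebesgue N"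
    using Usets negN by (intro measure_Un_le fmeasurableD) (auto intro: negligible_imp_measurable)
  also have "\<dots> = measure lebesgue (\<Union>s\<in>F. L s ` pos_simplex (1 / e))"
    using negN by (simp add: negligible_imp_measure0)
  also have "\<dots> \<le> (\<Sum>s\<in>F. measure lebesgue (L s ` pos_simplex (1 / e)))"
    using finF simplex linL by (intro measure_UNION_le fmeasurableD measurable_linear_image)
  also have "\<dots> = \<Delta> * ((1 / e) ^ ?k / fact ?k)"
    unfolding \<Delta>_def sum_distrib_right using simplex linL by (simp add: measure_linear_image)
  finally have V: "measure lebesgue (A ` cross_polytope) \<le> \<Delta> * ((1 / e) ^ ?k / fact ?k)" .

  let ?O = "?B \<inter> pos_orthant"
  have O: "?O \<in> lmeasurable"
    by (rule fmeasurable_Int_fmeasurable[OF lmeasurable_ball pos_orthant_lebesgue])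
  have ball: "measure lebesgue ?B = 2 ^ ?k * measure lebesgue ?O"
  proof (rule measure_sign_symmetric)
    show "y \<in> ?B" if "x \<in> ?B" "\<And>i. \<bar>y $ i\<bar> = \<bar>x $ i\<bar>" for x y
      using that by (simp add: norm_vec_def)
  qed simp
  \<comment> \<open>Disjoint cones make the measures of the images of \<open>?O\<close> add up to
    that of their union, which has to fit into the ball outside \<open>U\<close>.\<close>
  have "\<Delta> * measure lebesgue ?O = (\<Sum>s\<in>F. measure lebesgue (L s ` ?O))"
    unfolding \<Delta>_def sum_distrib_right using O linL by (simp add: measure_linear_image)
  also have "\<dots> = measure lebesgue (\<Union>s\<in>F. L s ` ?O)"
  proof (rule measure_UNION'[symmetric, OF finF])
    show "L s ` ?O \<in> lmeasurable" for s using O linL by (intro measurable_linear_image)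
    show "pairwise (\<lambda>s s'. disjnt (L s ` ?O) (L s' ` ?O)) F"
    proof (rule pairwiseI)
      fix s s' assume "s \<in> F" "s' \<in> F" "s \<noteq> s'"
      from disj[OF this] have "disjnt (L s ` pos_orthant) (L s' ` pos_orthant)"
        by (simp add: disjnt_def)
      then show "disjnt (L s ` ?O) (L s' ` ?O)"
        by (rule disjnt_subset1[OF disjnt_subset2]) (auto intro: image_mono)
    qed
  qed
  also have "\<dots> \<le> measure lebesgue (?B - U)"
  proof (rule measure_mono_fmeasurable)
    show "(\<Union>s\<in>F. L s ` ?O) \<subseteq> ?B - U"
    proof
      fix z assume "z \<in> (\<Union>s\<in>F. L s ` ?O)"
      then obtain s x where s: "s \<in> F" and x: "x \<in> ?O" and z: "z = A (E s x)"
        by (auto simp: L_def)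
      have lt: "norm (E s x) < 1" using normE[OF s] x by simp
      have "card (vec_supp (E s x)) \<le> ?k"
        using x optE[OF s] by (intro card_supp_optimal[OF A gen]) simp
      with avoid[of "E s x"] lt have "z \<notin> U" unfolding z by force
      moreover have "norm z < 1" unfolding z using normA[of "E s x"] lt by linarith
      ultimately show "z \<in> ?B - U" by simp
    qed
    show "(\<Union>s\<in>F. L s ` ?O) \<in> sets lebesgue"
      using finF O linL by (intro fmeasurableD fmeasurable.finite_UN measurable_linear_image)
    show "?B - U \<in> lmeasurable" using U by (intro fmeasurable_Diff fmeasurableD) simp
  qed
  also have "\<dots> = measure lebesgue ?B - measure lebesgue U"
  proof (rule measure_Diff[OF _ _ fmeasurableD[OF U(1)] U(2)])
    show "emeasure lebesgue ?B \<noteq> \<infinity>"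
      using fmeasurableD2[OF lmeasurable_ball] unfolding infinity_ennreal_def .
  qed simp
  finally have W: "\<Delta> * measure lebesgue ?O \<le> measure lebesgue ?B - measure lebesgue U" .

  \<comment> \<open>Elimination of \<open>\<Delta>\<close> between \<open>V\<close> and
    \<open>W\<close>, using that the ball has \<open>2 ^ ?k\<close> times the volume of
    \<open>?O\<close>.\<close>
  have "e ^ ?k * measure lebesgue (A ` cross_polytope) \<le> e ^ ?k * (\<Delta> * ((1 / e) ^ ?k / fact ?k))"
    using V e by (intro mult_left_mono) simp_all
  also have "\<dots> = \<Delta> / fact ?k" using e by (simp add: power_one_over)
  finally have "e ^ ?k * measure lebesgue (A ` cross_polytope) \<le> \<Delta> / fact ?k" .
  then have "e ^ ?k * measure lebesgue (A ` cross_polytope) * measure lebesgue ?B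
      \<le> \<Delta> / fact ?k * measure lebesgue ?B"
    by (rule mult_right_mono) simp
  also have "\<dots> = 2 ^ ?k / fact ?k * (\<Delta> * measure lebesgue ?O)"
    by (simp add: ball)
  also have "\<dots> \<le> 2 ^ ?k / fact ?k * (measure lebesgue ?B - measure lebesgue U)"
    using W by (intro mult_left_mono) auto
  finally show ?thesis by (simp add: mult.assoc)
qed

text \<open>Neither side depends on the weights, so \<open>e\<close> can tend to 1 from the
  left.\<close>

lemma measure_projection_le:
  fixes A :: "real ^ 'n \<Rightarrow> real ^ 'k::{finite, wellorder}"
  assumes "linear A" "\<And>c. norm (A c) \<le> norm c"
    and "U \<in> lmeasurable" "U \<subseteq> ball 0 1"
    and "\<And>c. A c \<in> U \<Longrightarrow> card (vec_supp c) \<le> CARD('k::_) \<Longrightarrow> 1 \<le> norm c"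
  shows "measure lebesgue (A ` cross_polytope) * measure lebesgue (ball 0 1 :: (real ^ 'k::_) set)
      \<le> 2 ^ CARD('k::_) / fact CARD('k::_) * (measure lebesgue (ball 0 1 :: (real ^ 'k::_) set) - measure lebesgue U)"
    (is "?l \<le> ?r")
proof -
  have "((\<lambda>e. e ^ CARD('k::_) * ?l) \<longlongrightarrow> 1 ^ CARD('k::_) * ?l) (at_left (1 :: real))"
    by (intro tendsto_intros)
  moreover have "\<forall>\<^sub>F e in at_left (1 :: real). e ^ CARD('k::_) * ?l \<le> ?r"
    using eventually_at_left_real[of 0 "1 :: real"]
  proof (rule eventually_mono)
    fix e :: real assume "e \<in> {0<..<1}"
    then show "e ^ CARD('k::_) * ?l \<le> ?r" using measure_projection_le_aux[OF assms] by simp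
  qed simp
  ultimately have "1 ^ CARD('k::_) * ?l \<le> ?r"
    by (rule tendsto_upperbound) simp
  then show ?thesis by simp
qed

section \<open>Isometries, adjoints and orthogonal projections\<close>

lemma isometry_inner:
  fixes f :: "'a::real_inner \<Rightarrow> 'b::real_inner"
  assumes "linear f" "\<And>x. norm (f x) = norm x"
  shows "f x \<bullet> f y = x \<bullet> y"
  unfolding dot_norm linear_add[OF assms(1), symmetric] assms(2) ..

lemma adjoint_isometry:
  fixes f :: "real ^ 'k \<Rightarrow> real ^ 'n"
  assumes "linear f" "\<And>x. norm (f x) = norm x"
  shows "adjoint f (f x) = x"
proof -
  have "z \<bullet> adjoint f (f x) = z \<bullet> x" for z
    unfolding adjoint_works[OF assms(1)] by (rule isometry_inner[OF assms])
  then show ?thesis using vector_eq_ldot[of "adjoint f (f x)" x] by blast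
qed

lemma norm_adjoint_isometry_le:
  fixes f :: "real ^ 'k \<Rightarrow> real ^ 'n"
  assumes "linear f" "\<And>x. norm (f x) = norm x"
  shows "norm (adjoint f c) \<le> norm c"
proof -
  have "norm (adjoint f c) * norm (adjoint f c) = adjoint f c \<bullet> adjoint f c"
    by (simp add: power2_norm_eq_inner flip: power2_eq_square)
  also have "\<dots> = f (adjoint f c) \<bullet> c" using assms by (simp add: adjoint_works)
  also have "\<dots> \<le> norm (adjoint f c) * norm c"
    using norm_cauchy_schwarz[of "f (adjoint f c)" c] assms by simp
  finally show ?thesis by (cases "adjoint f c = 0") auto
qed

text \<open>The residual is orthogonal to the range since \<open>f\<close> preserves inner products.
  Two candidates differ by a vector of the range that is orthogonal to the range.\<close>

lemma orth_proj_range_isometry: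
  fixes f :: "real ^ 'k \<Rightarrow> real ^ 'n"
  assumes f: "linear f" "\<And>x. norm (f x) = norm x"
  shows "orth_proj (range f) c = f (adjoint f c)"
  unfolding orth_proj_def
proof (rule the_equality)
  have *: "(c - f (adjoint f c)) \<bullet> f z = 0" for z
    using isometry_inner[OF f] adjoint_works[OF f(1), of z c]
    by (simp add: inner_diff_left) (simp add: inner_commute)
  then show "f (adjoint f c) \<in> range f \<and> (\<forall>h\<in>range f. (c - f (adjoint f c)) \<bullet> h = 0)" by auto
  fix y assume y: "y \<in> range f \<and> (\<forall>h\<in>range f. (c - y) \<bullet> h = 0)"
  then obtain z where z: "y = f z" by auto
  have "(y - f (adjoint f c)) \<bullet> f w = 0" for w
    using * [of w] y by (auto simp: inner_diff_left)
  moreover have "y - f (adjoint f c) = f (z - adjoint f c)" using f by (simp add: z linear_diff)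
  ultimately have "(y - f (adjoint f c)) \<bullet> (y - f (adjoint f c)) = 0" by simp
  then show "y = f (adjoint f c)" by simp
qed

text \<open>Turns volume in the subspace into Lebesgue measure of a linear image of
  \<open>K\<close>.\<close>

lemma vimage_proj_set:
  fixes f :: "real ^ 'k \<Rightarrow> real ^ 'n"
  assumes f: "linear f" "\<And>x. norm (f x) = norm x"
  shows "f -` proj_set K (range f) = adjoint f ` K"
proof -
  have inj: "f x = f y \<longleftrightarrow> x = y" for x y
    using adjoint_isometry[OF f] by metis
  have "proj_set K (range f) = f ` adjoint f ` K"
    unfolding proj_set_def image_image by (simp add: orth_proj_range_isometry[OF f])
  then show ?thesis by (auto simp: inj)
qed

text \<open>Links the frame to coordinates: if u_i is 0, the range of \<open>f\<close> lies in the
  i-th coordinate hyperplane.\<close>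

lemma nth_linear_adjoint:
  fixes f :: "real ^ 'k \<Rightarrow> real ^ 'n"
  assumes "linear f"
  shows "f x $ i = x \<bullet> adjoint f (axis i 1)"
proof -
  have "f x \<bullet> axis i 1 = f x $ i" by (simp add: inner_axis)
  then show ?thesis unfolding adjoint_works[OF assms] by simp
qed

section \<open>Strictness when more than k frame vectors are nonzero\<close>

text \<open>The images of sparse vectors of the closed unit ball form a closed set \<open>M\<close>.
  Some unit vector \<open>u\<close> has no sparse representation of norm at most 1, so a nonempty
  open part of the ball near \<open>u\<close> avoids \<open>M\<close> and can serve as
  \<open>U\<close>.\<close>

lemma measure_projection_less:
  fixes f :: "real ^ 'k::{finite, wellorder} \<Rightarrow> real ^ 'n"
  assumes f: "linear f" "\<And>x. norm (f x) = norm x"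
    and card: "CARD('k::_) < card {i. adjoint f (axis i 1) \<noteq> 0}"
  shows "measure lebesgue (adjoint f ` cross_polytope) < 2 ^ CARD('k::_) / fact CARD('k::_)"
proof -
  let ?k = "CARD('k::_)"
  let ?B = "ball 0 1 :: (real ^ 'k::_) set"
  define A where "A = adjoint f"
  have A: "linear A" unfolding A_def using f by (intro adjoint_linear)
  define I where "I = {i. A (axis i 1) \<noteq> 0}"
  have cardI: "?k < card I" using card by (simp add: I_def A_def)
  define M where "M = (\<Union>T\<in>{T. card T \<le> ?k}. A ` (cball 0 1 \<inter> {c. vec_supp c \<subseteq> T}))"
  have "compact (A ` (cball 0 1 \<inter> {c. vec_supp c \<subseteq> T}))" for T
  proof -
    have "{c :: real ^ 'n. vec_supp c \<subseteq> T} = (\<Inter>i\<in>-T. {c. c $ i = 0})"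
      by (auto simp: vec_supp_def)
    moreover have "closed {c :: real ^ 'n. c $ i = 0}" for i
      by (intro closed_Collect_eq continuous_intros)
    ultimately have "closed {c :: real ^ 'n. vec_supp c \<subseteq> T}" by (auto intro: closed_INT)
    then show ?thesis
      using A by (intro compact_continuous_image compact_Int_closed linear_continuous_on)
        (auto simp: linear_conv_bounded_linear)
  qed
  then have "closed M"
    unfolding M_def by (intro closed_UN) (auto intro: compact_imp_closed)
  define U where "U = ?B - M"
  have "open U" unfolding U_def using \<open>closed M\<close> by (intro open_Diff) auto
  have U: "U \<in> lmeasurable"
    using \<open>open U\<close> by (intro lmeasurable_open) (auto simp: U_def intro: bounded_subset[of ?B])
  \<comment> \<open>The direction of \<open>u\<close> is chosen off the hyperplanes orthogonal to
    the nonzero u_i, so that \<open>f u\<close> has more than k nonzero coordinates.\<close>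
  have "negligible (\<Union>i\<in>I. {x. A (axis i 1) \<bullet> x = 0})"
    by (intro negligible_Union) (auto intro!: negligible_hyperplane simp: I_def)
  then have "\<not> UNIV \<subseteq> (\<Union>i\<in>I. {x. A (axis i 1) \<bullet> x = 0})"
    using open_not_negligible[OF open_UNIV UNIV_not_empty] negligible_subset by blast
  then obtain x where x: "\<And>i. i \<in> I \<Longrightarrow> A (axis i 1) \<bullet> x \<noteq> 0"
    by auto
  have "I \<noteq> {}" using cardI by auto
  with x have "x \<noteq> 0" by auto
  define u where "u = x /\<^sub>R norm x"
  have u: "norm u = 1" "\<And>i. i \<in> I \<Longrightarrow> u \<bullet> A (axis i 1) \<noteq> 0"
    using x \<open>x \<noteq> 0\<close> by (auto simp: u_def inner_commute)
  text \<open>\<^term>\<open>f u\<close> is the only representation of \<^term>\<open>u\<close> of norm at most 1,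
    and none of its coordinates in \<^term>\<open>I\<close> vanishes.\<close>
  have "u \<notin> M"
  proof
    assume "u \<in> M"
    then obtain T c where c: "card T \<le> ?k" "u = A c" "norm c \<le> 1" "vec_supp c \<subseteq> T"
      by (auto simp: M_def)
    have "u \<bullet> u = 1" using u by (simp add: norm_eq_1)
    then have "f u \<bullet> c = 1"
      using adjoint_works[OF f(1), of u c] c(2) by (simp add: A_def)
    moreover have "f u \<bullet> f u = 1" using f u by (metis norm_eq_1)
    moreover have "c \<bullet> c \<le> 1" using c(3) by (simp add: norm_le_square)
    \<comment> \<open>The equality case of Cauchy-Schwarz: the left side is at most 1 - 2 +
      1.\<close>
    ultimately have "(c - f u) \<bullet> (c - f u) \<le> 0"
      by (simp add: inner_diff_left inner_diff_right inner_commute)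
    then have "c = f u" by (metis eq_iff_diff_eq_0 inner_eq_zero_iff inner_ge_zero order_antisym)
    then have "I \<subseteq> vec_supp c"
      using u(2) f by (auto simp: vec_supp_def nth_linear_adjoint A_def)
    then have "card I \<le> card T" using c(4) by (intro card_mono) auto
    with c(1) cardI show False by simp
  qed
  \<comment> \<open>\<open>u\<close> lies on the sphere and not in the open ball, but its open
    neighbourhood \<open>- M\<close> must meet the ball.\<close>
  moreover have "u \<in> closure ?B" using u by simp
  ultimately have "(- M) \<inter> ?B \<noteq> {}"
    using open_Int_closure_eq_empty[of "- M" ?B] \<open>closed M\<close> by (auto simp: open_Compl)
  then have "U \<noteq> {}" by (auto simp: U_def)
  with \<open>open U\<close> U have "measure lebesgue U \<noteq> 0"
    using open_not_negligible negligible_iff_measure0 by blast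
  then have U0: "0 < measure lebesgue U" by (simp add: less_le)
  have B0: "0 < measure lebesgue ?B" by (simp add: content_ball_pos)
  have "measure lebesgue (A ` cross_polytope) * measure lebesgue ?B
      \<le> 2 ^ ?k / fact ?k * (measure lebesgue ?B - measure lebesgue U)"
  proof (rule measure_projection_le[OF A _ U])
    show "norm (A c) \<le> norm c" for c unfolding A_def by (rule norm_adjoint_isometry_le[OF f])
    show "U \<subseteq> ?B" by (auto simp: U_def)
    show "1 \<le> norm c" if "A c \<in> U" "card (vec_supp c) \<le> ?k" for c
    proof (rule ccontr)
      assume "\<not> 1 \<le> norm c"
      then have "A c \<in> A ` (cball 0 1 \<inter> {d. vec_supp d \<subseteq> vec_supp c})" by auto
      with that show False unfolding U_def M_def by blast
    qed
  qed
  also have "\<dots> < 2 ^ ?k / fact ?k * measure lebesgue ?B"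
    using U0 by (intro mult_strict_left_mono) auto
  finally show ?thesis unfolding A_def
    by (rule mult_right_less_imp_less) (use B0 in simp)
qed

section \<open>Coordinate subspaces and the equality case\<close>

lemma supp_in_span_axis:
  assumes "vec_supp c \<subseteq> I"
  shows "c \<in> span ((\<lambda>i. axis i 1 :: real ^ 'n) ` I)"
proof -
  have "c $ i *\<^sub>R axis i 1 \<in> span ((\<lambda>i. axis i 1 :: real ^ 'n) ` I)" for i
  proof (cases "i \<in> I")
    case False
    with assms have "c $ i = 0" by (auto simp: vec_supp_def)
    then show ?thesis by (simp add: span_zero)
  qed (auto intro: span_scale span_base)
  then have "(\<Sum>i\<in>UNIV. c $ i *\<^sub>R axis i 1) \<in> span ((\<lambda>i. axis i 1 :: real ^ 'n) ` I)"
    by (intro span_sum)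
  then show ?thesis using basis_expansion[of c] by (simp add: scalar_mult_eq_scaleR)
qed

text \<open>The coordinate embedding \<open>h\<close> has its image in the range of
  \<open>f\<close>, so \<open>adjoint f \<circ> h\<close> is orthogonal. It maps the small
  cross-polytope, without change of volume, into the projection of the large one.\<close>

lemma measure_projection_coordinate_ge:
  fixes f :: "real ^ 'k::{finite, wellorder} \<Rightarrow> real ^ 'n"
  assumes f: "linear f" "\<And>x. norm (f x) = norm x"
    and I: "range f = span ((\<lambda>i. axis i 1) ` I)" "card I = CARD('k::_)"
  shows "2 ^ CARD('k::_) / fact CARD('k::_) \<le> measure lebesgue (adjoint f ` cross_polytope)"
proof -
  obtain b where b: "bij_betw b I (UNIV :: 'k::_ set)"
    using I(2) finite_same_card_bij[of I "UNIV :: 'k::_ set"] by auto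
  define s where "s = (\<chi> i. if i \<in> I then 1 else (0 :: real))"
  have s: "s $ i \<in> {-1, 0, 1}" "vec_supp s = I" for i by (auto simp: s_def vec_supp_def)
  define h where "h = signed_embedding b s"
  have h: "linear h" "norm (h x) = norm x" for x
    unfolding h_def using s b by (auto intro: linear_signed_embedding norm_signed_embedding)
  have fh: "f (adjoint f (h x)) = h x" for x
  proof -
    have "vec_supp (h x) \<subseteq> I" by (auto simp: h_def signed_embedding_def s_def vec_supp_def)
    then have "h x \<in> range f" using I supp_in_span_axis by metis
    then show ?thesis using adjoint_isometry[OF f] by auto
  qed
  have "norm (adjoint f (h x)) = norm x" for x using fh h f by metis
  then have orth: "orthogonal_transformation (adjoint f \<circ> h)"
    using f h unfolding orthogonal_transformation by (auto intro!: linear_compose adjoint_linear)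
  have "h ` cross_polytope \<subseteq> cross_polytope"
  proof
    fix y assume "y \<in> h ` cross_polytope"
    then obtain x where x: "y = h x" "(\<Sum>j\<in>UNIV. \<bar>x $ j\<bar>) \<le> 1" by (auto simp: cross_polytope_def)
    then show "y \<in> cross_polytope"
      using sum_signed_embedding[OF s(1), of b "\<lambda>j. \<bar>x $ j\<bar>"] b s(2)
      by (simp add: cross_polytope_def h_def signed_embedding_def abs_mult)
  qed
  then have "(adjoint f \<circ> h) ` cross_polytope \<subseteq> adjoint f ` cross_polytope" by auto
  then have "measure lebesgue ((adjoint f \<circ> h) ` cross_polytope) \<le> measure lebesgue (adjoint f ` cross_polytope)"
    using orth adjoint_linear[OF f(1)]
    by (intro measure_mono_fmeasurable fmeasurableD measurable_orthogonal_image lmeasurable_compact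
        lmeasurable_linear_cross_polytope compact_cross_polytope)
  then show ?thesis
    using measure_orthogonal_image[OF orth lmeasurable_compact[OF compact_cross_polytope]]
    by (simp add: measure_cross_polytope)
qed

text \<open>The empty \<open>U\<close> gives the bound. In the equality case at most k of the u_i
  are nonzero, so \<open>H\<close> lies in the span of at most k axes, and its dimension leaves only
  equality.\<close>

lemma subspace_vol_projection_cross_polytope:
  fixes H :: "(real ^ 'n) set"
  assumes H: "subspace H" "dim H = CARD('k::{finite, wellorder})"
  defines "V \<equiv> subspace_vol TYPE('k::_) H (proj_set cross_polytope H)"
  shows "V \<le> 2 ^ CARD('k::_) / fact CARD('k::_)"
    and "V = 2 ^ CARD('k::_) / fact CARD('k::_) \<longleftrightarrow> coordinate_subspace CARD('k::_) H"
proof -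
  let ?k = "CARD('k::_)"
  \<comment> \<open>The same choice as in \<open>subspace_vol\<close>, so that the definition can be
    folded; a library isometry shows that the choice is sound.\<close>
  define f where "f = (SOME f :: real ^ 'k::_ \<Rightarrow> real ^ 'n. linear f \<and> (\<forall>x. norm (f x) = norm x) \<and> range f = H)"
  have "\<exists>f :: real ^ 'k::_ \<Rightarrow> real ^ 'n. linear f \<and> (\<forall>x. norm (f x) = norm x) \<and> range f = H"
  proof -
    obtain g :: "real ^ 'k::_ \<Rightarrow> real ^ 'n" where "linear g" "range g = H" "\<And>x. norm (g x) = norm x"
      using isometry_subspaces[of "UNIV :: (real ^ 'k::_) set" H] H by auto
    then show ?thesis by blast
  qed
  from someI_ex[OF this] have f: "linear f" "\<And>x. norm (f x) = norm x" and rf: "range f = H"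
    by (auto simp: f_def)
  define A where "A = adjoint f"
  have V: "V = measure lebesgue (A ` cross_polytope)"
    unfolding V_def subspace_vol_def f_def[symmetric] A_def using vimage_proj_set[OF f] rf by simp
  have "V * measure lebesgue (ball 0 1 :: (real ^ 'k::_) set)
      \<le> 2 ^ ?k / fact ?k * measure lebesgue (ball 0 1 :: (real ^ 'k::_) set)"
    using measure_projection_le[of A "{}"] norm_adjoint_isometry_le[OF f] adjoint_linear[OF f(1)]
    by (simp add: A_def V)
  then show le: "V \<le> 2 ^ ?k / fact ?k"
    by (rule mult_right_le_imp_le) (simp add: content_ball_pos)
  show "V = 2 ^ ?k / fact ?k \<longleftrightarrow> coordinate_subspace ?k H"
  proof
    assume "coordinate_subspace ?k H"
    then show "V = 2 ^ ?k / fact ?k"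
      using measure_projection_coordinate_ge[OF f] le
      by (auto simp: coordinate_subspace_def rf V A_def intro: order_antisym)
  next
    assume max: "V = 2 ^ ?k / fact ?k"
    define J where "J = {i. A (axis i 1) \<noteq> 0}"
    have J: "card J \<le> ?k"
      using measure_projection_less[OF f] max by (force simp: V A_def J_def)
    have "vec_supp (f x) \<subseteq> J" for x
      using f by (auto simp: vec_supp_def J_def A_def nth_linear_adjoint)
    then have sub: "H \<subseteq> span ((\<lambda>i. axis i 1) ` J)"
      unfolding rf[symmetric] by (intro image_subsetI supp_in_span_axis)
    have "dim ((\<lambda>i. axis i 1 :: real ^ 'n) ` J) \<le> card J"
      by (rule order_trans[OF dim_le_card' card_image_le]) auto
    with J sub H have "H = span ((\<lambda>i. axis i 1) ` J)"
      by (intro subspace_dim_equal) auto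
    moreover have "card J = ?k"
      using \<open>dim _ \<le> card J\<close> J H dim_subset[OF sub] by simp
    ultimately show "coordinate_subspace ?k H" by (auto simp: coordinate_subspace_def)
  qed
qed

theorem theorem1:
  fixes H :: "(real ^ 'n) set"
  shows
   "(CARD('n) \<ge> 2 \<and> subspace H \<and> dim H = 2 \<longrightarrow>
       subspace_vol TYPE(2) H (proj_set cross_polytope H) \<le> 2 ^ 2 / fact 2 \<and>
       (subspace_vol TYPE(2) H (proj_set cross_polytope H) = 2 ^ 2 / fact 2
          \<longleftrightarrow> coordinate_subspace 2 H)) \<and>
    (CARD('n) \<ge> 3 \<and> subspace H \<and> dim H = 3 \<longrightarrow>
       subspace_vol TYPE(3) H (proj_set cross_polytope H) \<le> 2 ^ 3 / fact 3 \<and>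
       (subspace_vol TYPE(3) H (proj_set cross_polytope H) = 2 ^ 3 / fact 3
          \<longleftrightarrow> coordinate_subspace 3 H))"
proof -
  have card: "CARD(2) = 2" "CARD(3) = 3" by simp_all
  show ?thesis
    using subspace_vol_projection_cross_polytope[of H, where 'k = 2]
      subspace_vol_projection_cross_polytope[of H, where 'k = 3]
    unfolding card by blast
qed

end
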